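(* Consider the forward Euler update $\bar f^{\,n+1}_{ikm}=\bar f^{\,n}_{ikm}+\Gamma_T+\Gamma_C$ of the cell averages of the upwind discontinuous Galerkin (DG) scheme for the 1D-position/2D-momentum Boltzmann equation (all terms are defined in the context), with time step $\Delta t^n>0$. Let $\eta\in(0,1)$, let $s_1,s_2,s_3>0$ with $s_1+s_2+s_3=1$, and write $$\bar f^{\,n+1}_{ikm}=\eta\, I+(1-\eta)\,II,\qquad I=\bar f^{\,n}_{ikm}+\frac{\Gamma_T}{\eta},\qquad II=\bar f^{\,n}_{ikm}+\frac{\Gamma_C}{1-\eta}.$$ (1) Suppose that at time $t^n$ the function $f_h$ is positive at all Gauss–Lobatto points (including the traces at cell endpoints, from both sides). If $$\Delta t^n\le\frac{\eta s_1\hat w_N\,\Delta x_i}{\max_{\hat r}\partial_p\varepsilon(p_{\hat r})\cdot\max_\pm|\mu_{m\pm}|},\quad \Delta t^n\le\frac{\eta s_2\hat w_N\,\Delta p_k}{q\max_{\hat q}|E(x_{\hat q},t)|\cdot\max_\pm|\mu_{m\pm}|},\quad \Delta t^n\le\frac{\eta s_3\hat w_N\,\Delta\mu_m\,p_{k-}}{q\max_{\hat q}|E(x_{\hat q},t)|\cdot\max_\pm(1-\mu_{m\pm}^2)},$$ then $I\ge0$. (2) Suppose that at time $t^n$ the function $f_h$ is positive at the quadrature points $(x_s,p_r,\mu_q)$ of the cell used for the collision integrals. Then $II\ge0$ if either of the following holds: (a) $f_h>0$ also at all the points $(x_s,\,p(\varepsilon(p_r)+j\hbar\omega),\,\mu'_q)$,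 $j\in\{-1,0,1\}$, with $\varepsilon(p_r)+j\hbar\omega\in[0,\varepsilon_{\max}]$, at which the gain term is evaluated, and $$\Delta t^n<\frac{1-\eta}{\max_{p_r}\,4\pi\sum_{j=-1}^{1}c_j\,\chi(\varepsilon')\,p(\varepsilon')^2\frac{dp}{d\varepsilon}(\varepsilon')\big|_{\varepsilon'=\varepsilon(p_r)-j\hbar\omega}};$$ (b) $$\Delta t^n\le(1-\eta)\min_{Q(f_h)(x_q,p_r,\mu_s,t^n)<0}\frac{f_h(x_q,p_r,\mu_s,t^n)}{|Q(f_h)|(x_q,p_r,\mu_s,t^n)},$$ where the minimum is over those quadrature points of $\Omega_{ikm}$ at which $Q(f_h)<0$. Consequently, if the hypotheses and time-step restrictions of (1) and of (2) (either (a) or (b)) hold, then $\bar f^{\,n+1}_{ikm}\ge0$.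
   Context: **Domain and data.** Coordinates $(x,p,\mu)\in[0,L]\times[0,p_{\max}]\times[-1,1]$. Cells are $\Omega_{ikm}=[x_{i-},x_{i+}]\times[p_{k-},p_{k+}]\times[\mu_{m-},\mu_{m+}]$ with side lengths $\Delta x_i,\Delta p_k,\Delta\mu_m$. $\partial_x\Omega_{km}=[p_{k-},p_{k+}]\times[\mu_{m-},\mu_{m+}]$, $\partial_p\Omega_{im}=[x_{i-},x_{i+}]\times[\mu_{m-},\mu_{m+}]$, $\partial_\mu\Omega_{ik}=[x_{i-},x_{i+}]\times[p_{k-},p_{k+}]$. $f_h$ is polynomial on each cell. $\varepsilon(p)$ is continuously differentiable with $\partial_p\varepsilon>0$ and inverse $p(\varepsilon)$; $\varepsilon_{\max}=\varepsilon(p_{\max})$; $\chi$ is the indicator of $[0,\varepsilon_{\max}]$; $q>0$; $E(x,t)$ is the electric field; $\hbar\omega>0$ is the phonon energy; $c_{-1},c_0,c_1>0$. **Cell average.** $\bar f_{ikm}=\frac1{V_{ikm}}\int_{\Omega_{ikm}}f_h\,p^2\,dp\,d\mu\,dx$, with $V_{ikm}=\int_{\Omega_{ikm}}p^2\,dp\,d\mu\,dx$. **Transport term.** $$\Gamma_T=-\frac{\Delta t^n}{V_{ikm}}\Big[\int_{\partial_x\Omega_{km}}\big(\widehat{H^{(x)}f_h}|_{x_{i+}}-\widehat{H^{(x)}f_h}|_{x_{i-}}\big)p^2\,dp\,d\mu+\int_{\partial_p\Omega_{im}}\big(p_{k+}^2\widehat{H^{(p)}f_h}|_{p_{k+}}-p_{k-}^2\widehat{H^{(p)}f_h}|_{p_{k-}}\big)d\mu\,dx$$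 $$\qquad+\int_{\partial_\mu\Omega_{ik}}\big((1-\mu_{m+}^2)\widehat{H^{(\mu)}f_h}|_{\mu_{m+}}-(1-\mu_{m-}^2)\widehat{H^{(\mu)}f_h}|_{\mu_{m-}}\big)p\,dp\,dx\Big].$$ The upwind fluxes are (superscripts $-$/$+$ are traces from smaller/larger values of the coordinate normal to the face) $$\widehat{H^{(x)}f_h}=\partial_p\varepsilon\Big[\tfrac{\mu+|\mu|}2f_h^-+\tfrac{\mu-|\mu|}2f_h^+\Big],\quad \widehat{H^{(p)}f_h}=q\Big[\tfrac{|E\mu|-E\mu}2f_h^--\tfrac{E\mu+|E\mu|}2f_h^+\Big],\quad \widehat{H^{(\mu)}f_h}=q\Big[\tfrac{-E+|E|}2f_h^-+\tfrac{-E-|E|}2f_h^+\Big].$$ **Collision term.** $\Gamma_C=\frac{\Delta t^n}{V_{ikm}}\int_{\Omega_{ikm}}Q(f_h)\,p^2\,dp\,d\mu\,dx$, with $$Q(f)=2\pi\sum_{j=-1}^1c_j\,\chi(\varepsilon')p(\varepsilon')^2\tfrac{dp}{d\varepsilon}(\varepsilon')\int_{-1}^1f(x,p(\varepsilon'),\mu')\,d\mu'\Big|_{\varepsilon'=\varepsilon(p)+j\hbar\omega}-4\pi f\sum_{j=-1}^1c_j\,\chi(\varepsilon')p(\varepsilon')^2\tfrac{dp}{d\varepsilon}(\varepsilon')\Big|_{\varepsilon'=\varepsilon(p)-j\hbar\omega}.$$ **Quadrature.** All integrals are evaluated by quadrature with positive weights. In the transport part $I$, Gauss–Lobatto quadrature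 with $N$ points is used in each coordinate on each cell (nodes $x_{\hat q},p_{\hat r},\mu_{\hat s}$, containing the interval endpoints; weights $\hat w_1,\dots,\hat w_N>0$ normalized to sum to 1, with $\hat w_1=\hat w_N$). In the collision part $II$, a tensor Gaussian quadrature with positive weights and nodes $(x_q,p_r,\mu_s)$ in the cell is used, with nodes $\mu'_q$ and positive weights for the $\mu'$-integral. These rules are exact for the integrals of $f_h\,p^2$ defining the cell average. *)

theory Defs
  imports "HOL-Analysis.Analysis"
begin

text \<open>
  Quadrature rules live on the reference interval \<open>[0, 1]\<close>, with indices \<open>1, \<dots>, npts R\<close>;
  \<open>qnode\<close> and \<open>quad\<close> transport them affinely to \<open>[a, b]\<close>.
\<close>

record quad_rule =
  npts :: nat
  node :: "nat \<Rightarrow> real"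
  weight :: "nat \<Rightarrow> real"

definition qnode :: "quad_rule \<Rightarrow> real \<Rightarrow> real \<Rightarrow> nat \<Rightarrow> real" where
  "qnode R a b j = a + (b - a) * node R j"

definition quad :: "quad_rule \<Rightarrow> real \<Rightarrow> real \<Rightarrow> (real \<Rightarrow> real) \<Rightarrow> real" where
  "quad R a b g = (b - a) * (\<Sum>j = 1..npts R. weight R j * g (qnode R a b j))"

definition exact_upto :: "quad_rule \<Rightarrow> nat \<Rightarrow> bool" where
  "exact_upto R d \<longleftrightarrow> (\<forall>n\<le>d. quad R 0 1 (\<lambda>y. y ^ n) = integral {0..1} (\<lambda>y. y ^ n))"

definition positive_rule :: "quad_rule \<Rightarrow> bool" where
  "positive_rule R \<longleftrightarrow> 1 \<le> npts R \<and>
     (\<forall>j\<in>{1..npts R}. node R j \<in> {0..1} \<and> 0 < weight R j)"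

definition gauss_rule :: "quad_rule \<Rightarrow> bool" where
  "gauss_rule R \<longleftrightarrow> positive_rule R \<and> strict_mono_on {1..npts R} (node R) \<and>
     (\<forall>j\<in>{1..npts R}. node R j \<in> {0<..<1}) \<and> exact_upto R (2 * npts R - 1)"

definition gauss_lobatto_rule :: "quad_rule \<Rightarrow> bool" where
  "gauss_lobatto_rule R \<longleftrightarrow> 2 \<le> npts R \<and> positive_rule R \<and>
     strict_mono_on {1..npts R} (node R) \<and> node R 1 = 0 \<and> node R (npts R) = 1 \<and>
     (\<Sum>j = 1..npts R. weight R j) = 1 \<and> weight R 1 = weight R (npts R) \<and>
     exact_upto R (2 * npts R - 3)"


record boltzmann_data =
  length_x :: real                          \<comment> \<open>\<open>L\<close>\<close>
  pmax :: real
  energy :: "real \<Rightarrow> real"                   \<comment> \<open>\<open>p \<mapsto> \<epsilon>(p)\<close>\<close>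
  charge :: real                            \<comment> \<open>\<open>q\<close>\<close>
  efield :: "real \<Rightarrow> real \<Rightarrow> real"             \<comment> \<open>\<open>(x, t) \<mapsto> E(x, t)\<close>\<close>
  phonon :: real                            \<comment> \<open>the phonon energy \<open>\<hbar>\<omega>\<close>\<close>
  rate :: "int \<Rightarrow> real"                      \<comment> \<open>\<open>c\<^sub>j\<close> for \<open>j = -1, 0, 1\<close>\<close>

definition emax :: "boltzmann_data \<Rightarrow> real" where
  "emax D = energy D (pmax D)"

text \<open>
  Derivatives are one-sided at the end points of the intervals
  \<open>[0, pmax]\<close> and \<open>[0, \<epsilon>(pmax)]\<close>.
\<close>

definition denergy :: "boltzmann_data \<Rightarrow> real \<Rightarrow> real" where
  "denergy D p = vector_derivative (energy D) (at p within {0..pmax D})"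

definition momentum :: "boltzmann_data \<Rightarrow> real \<Rightarrow> real" where
  "momentum D = inv_into {0..pmax D} (energy D)"

definition dmomentum :: "boltzmann_data \<Rightarrow> real \<Rightarrow> real" where
  "dmomentum D e = vector_derivative (momentum D) (at e within {0..emax D})"

text \<open>
  Positivity of \<open>\<partial>\<^sub>p\<epsilon>\<close> is not required at \<open>p = 0\<close>, so that
  bands with \<open>\<epsilon>(p) ~ p\<^sup>2\<close> near \<open>0\<close> are included. The condition \<open>\<epsilon>(0) = 0\<close> makes the inverse
  \<open>p(\<epsilon>)\<close> defined exactly on the support \<open>[0, emax]\<close> of the cut-off \<open>\<chi>\<close>.
\<close>

definition boltzmann_model :: "boltzmann_data \<Rightarrow> bool" where
  "boltzmann_model D \<longleftrightarrow>
     0 < length_x D \<and> 0 < pmax D \<and> energy D 0 = 0 \<and>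
     energy D differentiable_on {0..pmax D} \<and>
     continuous_on {0..pmax D} (denergy D) \<and>
     (\<forall>p\<in>{0<..pmax D}. 0 < denergy D p) \<and>
     0 < charge D \<and> 0 < phonon D \<and> (\<forall>j\<in>{-1..1}. 0 < rate D j)"


text \<open>
  The cells of each coordinate are numbered \<open>1, \<dots>, n\<close>; cell \<open>i\<close> is bounded by the faces
  \<open>i - 1\<close> and \<open>i\<close>.
\<close>

record mesh =
  cells_x :: nat
  cells_p :: nat
  cells_mu :: nat
  face_x :: "nat \<Rightarrow> real"
  face_p :: "nat \<Rightarrow> real"
  face_mu :: "nat \<Rightarrow> real"

definition partition_of :: "real \<Rightarrow> real \<Rightarrow> nat \<Rightarrow> (nat \<Rightarrow> real) \<Rightarrow> bool" where
  "partition_of a b n F \<longleftrightarrow> 1 \<le> n \<and> F 0 = a \<and> F n = b \<and> (\<forall>i<n. F i < F (Suc i))"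

definition mesh_of :: "boltzmann_data \<Rightarrow> mesh \<Rightarrow> bool" where
  "mesh_of D T \<longleftrightarrow>
     partition_of 0 (length_x D) (cells_x T) (face_x T) \<and>
     partition_of 0 (pmax D) (cells_p T) (face_p T) \<and>
     partition_of (-1) 1 (cells_mu T) (face_mu T)"

definition cell_index :: "mesh \<Rightarrow> nat \<Rightarrow> nat \<Rightarrow> nat \<Rightarrow> bool" where
  "cell_index T i k m \<longleftrightarrow> i \<in> {1..cells_x T} \<and> k \<in> {1..cells_p T} \<and> m \<in> {1..cells_mu T}"

definition cell :: "mesh \<Rightarrow> nat \<Rightarrow> nat \<Rightarrow> nat \<Rightarrow> (real \<times> real \<times> real) set" where
  "cell T i k m =
     {face_x T (i - 1)..face_x T i} \<times> {face_p T (k - 1)..face_p T k} \<times>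
     {face_mu T (m - 1)..face_mu T m}"

text \<open>
  A discontinuous piecewise polynomial \<open>f\<^sub>h\<close> is two-valued on the faces. \<open>piece f i k m\<close> is the
  polynomial of cell \<open>(i, k, m)\<close>, which also supplies the traces from inside that cell.
  Pieces with an index \<open>0\<close> or \<open>n + 1\<close> supply the exterior traces on the boundary of the domain,
  i.e. the boundary data, and are not restricted. \<open>val f\<close> is a single-valued representative,
  used for point evaluation in the collision operator; its values on the faces are not
  restricted, so that every convention for them is covered.
\<close>

record dg_function =
  piece :: "nat \<Rightarrow> nat \<Rightarrow> nat \<Rightarrow> real \<times> real \<times> real \<Rightarrow> real"
  val :: "real \<times> real \<times> real \<Rightarrow> real"

definition dg_function_on :: "mesh \<Rightarrow> dg_function \<Rightarrow> bool" where
  "dg_function_on T f \<longleftrightarrow>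
     (\<forall>i k m. cell_index T i k m \<longrightarrow>
        real_polynomial_function (piece f i k m) \<and>
        (\<forall>z\<in>interior (cell T i k m). val f z = piece f i k m z))"

definition cell_volume :: "mesh \<Rightarrow> nat \<Rightarrow> nat \<Rightarrow> nat \<Rightarrow> real" where
  "cell_volume T i k m = integral (cell T i k m) (\<lambda>(x, p, \<mu>). p\<^sup>2)"

definition cell_average :: "mesh \<Rightarrow> dg_function \<Rightarrow> nat \<Rightarrow> nat \<Rightarrow> nat \<Rightarrow> real" where
  "cell_average T f i k m =
     1 / cell_volume T i k m *
     integral (cell T i k m) (\<lambda>(x, p, \<mu>). piece f i k m (x, p, \<mu>) * p\<^sup>2)"

definition tensor_quad ::
  "quad_rule \<Rightarrow> quad_rule \<Rightarrow> quad_rule \<Rightarrow> mesh \<Rightarrow> nat \<Rightarrow> nat \<Rightarrow> nat \<Rightarrow>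
   (real \<times> real \<times> real \<Rightarrow> real) \<Rightarrow> real" where
  "tensor_quad Rx Rp Rm T i k m g =
     quad Rx (face_x T (i - 1)) (face_x T i) (\<lambda>x.
       quad Rp (face_p T (k - 1)) (face_p T k) (\<lambda>p.
         quad Rm (face_mu T (m - 1)) (face_mu T m) (\<lambda>\<mu>. g (x, p, \<mu>))))"

definition exact_for_average ::
  "quad_rule \<Rightarrow> quad_rule \<Rightarrow> quad_rule \<Rightarrow> mesh \<Rightarrow> dg_function \<Rightarrow> nat \<Rightarrow> nat \<Rightarrow> nat \<Rightarrow> bool" where
  "exact_for_average Rx Rp Rm T f i k m \<longleftrightarrow>
     tensor_quad Rx Rp Rm T i k m (\<lambda>(x, p, \<mu>). piece f i k m (x, p, \<mu>) * p\<^sup>2) =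
     integral (cell T i k m) (\<lambda>(x, p, \<mu>). piece f i k m (x, p, \<mu>) * p\<^sup>2)"


text \<open>
  Upwind fluxes at time \<open>t\<close>. \<open>flux_x D T f i k m p \<mu>\<close> is the flux through face \<open>i\<close>, between the cells
  \<open>i\<close> and \<open>i + 1\<close> of the \<open>x\<close>-mesh; likewise in the other coordinates.
\<close>

definition flux_x ::
  "boltzmann_data \<Rightarrow> mesh \<Rightarrow> dg_function \<Rightarrow> nat \<Rightarrow> nat \<Rightarrow> nat \<Rightarrow> real \<Rightarrow> real \<Rightarrow> real" where
  "flux_x D T f i k m p \<mu> =
     denergy D p *
       ((\<mu> + \<bar>\<mu>\<bar>) / 2 * piece f i k m (face_x T i, p, \<mu>) +
        (\<mu> - \<bar>\<mu>\<bar>) / 2 * piece f (i + 1) k m (face_x T i, p, \<mu>))"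

definition flux_p ::
  "boltzmann_data \<Rightarrow> mesh \<Rightarrow> dg_function \<Rightarrow> real \<Rightarrow> nat \<Rightarrow> nat \<Rightarrow> nat \<Rightarrow> real \<Rightarrow> real \<Rightarrow> real" where
  "flux_p D T f t i k m x \<mu> =
     charge D *
       ((\<bar>efield D x t * \<mu>\<bar> - efield D x t * \<mu>) / 2 * piece f i k m (x, face_p T k, \<mu>) -
        (efield D x t * \<mu> + \<bar>efield D x t * \<mu>\<bar>) / 2 * piece f i (k + 1) m (x, face_p T k, \<mu>))"

definition flux_mu ::
  "boltzmann_data \<Rightarrow> mesh \<Rightarrow> dg_function \<Rightarrow> real \<Rightarrow> nat \<Rightarrow> nat \<Rightarrow> nat \<Rightarrow> real \<Rightarrow> real \<Rightarrow> real" where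
  "flux_mu D T f t i k m x p =
     charge D *
       ((- efield D x t + \<bar>efield D x t\<bar>) / 2 * piece f i k m (x, p, face_mu T m) +
        (- efield D x t - \<bar>efield D x t\<bar>) / 2 * piece f i k (m + 1) (x, p, face_mu T m))"

definition Gamma_T ::
  "boltzmann_data \<Rightarrow> mesh \<Rightarrow> quad_rule \<Rightarrow> dg_function \<Rightarrow> real \<Rightarrow> real \<Rightarrow> nat \<Rightarrow> nat \<Rightarrow> nat \<Rightarrow> real" where
  "Gamma_T D T R f t dt i k m =
     (let Ix = quad R (face_x T (i - 1)) (face_x T i);
          Ip = quad R (face_p T (k - 1)) (face_p T k);
          Im = quad R (face_mu T (m - 1)) (face_mu T m)
      in - (dt / cell_volume T i k m) *
         (Ip (\<lambda>p. Im (\<lambda>\<mu>. (flux_x D T f i k m p \<mu> - flux_x D T f (i - 1) k m p \<mu>) * p\<^sup>2)) +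
          Ix (\<lambda>x. Im (\<lambda>\<mu>. (face_p T k)\<^sup>2 * flux_p D T f t i k m x \<mu> -
                           (face_p T (k - 1))\<^sup>2 * flux_p D T f t i (k - 1) m x \<mu>)) +
          Ix (\<lambda>x. Ip (\<lambda>p. ((1 - (face_mu T m)\<^sup>2) * flux_mu D T f t i k m x p -
                            (1 - (face_mu T (m - 1))\<^sup>2) * flux_mu D T f t i k (m - 1) x p) * p))))"

text \<open>
  \<open>density_factor D e\<close> is \<open>\<chi>(e) p(e)\<^sup>2 (dp/d\<epsilon>)(e)\<close>. In the collision operator the integral over
  \<open>\<mu>'\<close> is evaluated by the rule \<open>A\<close> on \<open>[-1, 1]\<close>.
\<close>

definition density_factor :: "boltzmann_data \<Rightarrow> real \<Rightarrow> real" where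
  "density_factor D e = indicator {0..emax D} e * (momentum D e)\<^sup>2 * dmomentum D e"

definition loss_rate :: "boltzmann_data \<Rightarrow> real \<Rightarrow> real" where
  "loss_rate D p =
     4 * pi * (\<Sum>j\<in>{-1..1::int}. rate D j * density_factor D (energy D p - of_int j * phonon D))"

definition collision ::
  "boltzmann_data \<Rightarrow> quad_rule \<Rightarrow> (real \<times> real \<times> real \<Rightarrow> real) \<Rightarrow> real \<times> real \<times> real \<Rightarrow> real" where
  "collision D A g = (\<lambda>(x, p, \<mu>).
     2 * pi * (\<Sum>j\<in>{-1..1::int}.
        let e = energy D p + of_int j * phonon D
        in rate D j * density_factor D e * quad A (-1) 1 (\<lambda>\<mu>'. g (x, momentum D e, \<mu>')))
     - g (x, p, \<mu>) * loss_rate D p)"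

definition Gamma_C ::
  "boltzmann_data \<Rightarrow> mesh \<Rightarrow> quad_rule \<Rightarrow> quad_rule \<Rightarrow> quad_rule \<Rightarrow> quad_rule \<Rightarrow>
   dg_function \<Rightarrow> real \<Rightarrow> nat \<Rightarrow> nat \<Rightarrow> nat \<Rightarrow> real" where
  "Gamma_C D T Gx Gp Gm A f dt i k m =
     dt / cell_volume T i k m *
     tensor_quad Gx Gp Gm T i k m (\<lambda>(x, p, \<mu>). collision D A (val f) (x, p, \<mu>) * p\<^sup>2)"


text \<open>
  Positivity at the Gauss-Lobatto points of a cell, with the opposite traces on its faces.
  There is no opposite trace at \<open>p = 0\<close> and at \<open>\<mu> = -1, 1\<close>, where the geometric factors \<open>p\<^sup>2\<close> and
  \<open>1 - \<mu>\<^sup>2\<close> of the fluxes vanish.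
\<close>

definition lobatto_positive ::
  "mesh \<Rightarrow> quad_rule \<Rightarrow> dg_function \<Rightarrow> nat \<Rightarrow> nat \<Rightarrow> nat \<Rightarrow> bool" where
  "lobatto_positive T R f i k m \<longleftrightarrow>
     (let J = {1..npts R};
          x = qnode R (face_x T (i - 1)) (face_x T i);
          p = qnode R (face_p T (k - 1)) (face_p T k);
          \<mu> = qnode R (face_mu T (m - 1)) (face_mu T m)
      in (\<forall>a\<in>J. \<forall>b\<in>J. \<forall>c\<in>J. 0 < piece f i k m (x a, p b, \<mu> c)) \<and>
         (\<forall>b\<in>J. \<forall>c\<in>J. 0 < piece f (i - 1) k m (face_x T (i - 1), p b, \<mu> c) \<and>
                        0 < piece f (i + 1) k m (face_x T i, p b, \<mu> c)) \<and>
         (\<forall>a\<in>J. \<forall>c\<in>J. (1 < k \<longrightarrow> 0 < piece f i (k - 1) m (x a, face_p T (k - 1), \<mu> c)) \<and>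
                        0 < piece f i (k + 1) m (x a, face_p T k, \<mu> c)) \<and>
         (\<forall>a\<in>J. \<forall>b\<in>J. (1 < m \<longrightarrow> 0 < piece f i k (m - 1) (x a, p b, face_mu T (m - 1))) \<and>
                        (m < cells_mu T \<longrightarrow> 0 < piece f i k (m + 1) (x a, p b, face_mu T m))))"

definition cell_nodes ::
  "mesh \<Rightarrow> quad_rule \<Rightarrow> quad_rule \<Rightarrow> quad_rule \<Rightarrow> nat \<Rightarrow> nat \<Rightarrow> nat \<Rightarrow> (real \<times> real \<times> real) set" where
  "cell_nodes T Gx Gp Gm i k m =
     qnode Gx (face_x T (i - 1)) (face_x T i) ` {1..npts Gx} \<times>
     qnode Gp (face_p T (k - 1)) (face_p T k) ` {1..npts Gp} \<times>
     qnode Gm (face_mu T (m - 1)) (face_mu T m) ` {1..npts Gm}"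

definition gain_nodes ::
  "boltzmann_data \<Rightarrow> mesh \<Rightarrow> quad_rule \<Rightarrow> quad_rule \<Rightarrow> quad_rule \<Rightarrow> nat \<Rightarrow> nat \<Rightarrow>
   (real \<times> real \<times> real) set" where
  "gain_nodes D T Gx Gp A i k =
     {(x, momentum D e, \<mu>') | x e \<mu>'.
        x \<in> qnode Gx (face_x T (i - 1)) (face_x T i) ` {1..npts Gx} \<and>
        (\<exists>p\<in>qnode Gp (face_p T (k - 1)) (face_p T k) ` {1..npts Gp}. \<exists>j\<in>{-1..1::int}.
            e = energy D p + of_int j * phonon D) \<and>
        e \<in> {0..emax D} \<and>
        \<mu>' \<in> qnode A (-1) 1 ` {1..npts A}}"


definition cell_update ::
  "boltzmann_data \<Rightarrow> mesh \<Rightarrow> quad_rule \<Rightarrow> quad_rule \<Rightarrow> quad_rule \<Rightarrow> quad_rule \<Rightarrow> quad_rule \<Rightarrow>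
   dg_function \<Rightarrow> real \<Rightarrow> real \<Rightarrow> nat \<Rightarrow> nat \<Rightarrow> nat \<Rightarrow> real" where
  "cell_update D T R Gx Gp Gm A f t dt i k m =
     cell_average T f i k m + Gamma_T D T R f t dt i k m + Gamma_C D T Gx Gp Gm A f dt i k m"

definition transport_part ::
  "boltzmann_data \<Rightarrow> mesh \<Rightarrow> quad_rule \<Rightarrow> dg_function \<Rightarrow> real \<Rightarrow> real \<Rightarrow> real \<Rightarrow>
   nat \<Rightarrow> nat \<Rightarrow> nat \<Rightarrow> real" where
  "transport_part D T R f t dt \<eta> i k m =
     cell_average T f i k m + Gamma_T D T R f t dt i k m / \<eta>"

definition collision_part ::
  "boltzmann_data \<Rightarrow> mesh \<Rightarrow> quad_rule \<Rightarrow> quad_rule \<Rightarrow> quad_rule \<Rightarrow> quad_rule \<Rightarrow>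
   dg_function \<Rightarrow> real \<Rightarrow> real \<Rightarrow> nat \<Rightarrow> nat \<Rightarrow> nat \<Rightarrow> real" where
  "collision_part D T Gx Gp Gm A f dt \<eta> i k m =
     cell_average T f i k m + Gamma_C D T Gx Gp Gm A f dt i k m / (1 - \<eta>)"

text \<open>
  In the time-step restrictions, a bound whose denominator vanishes and a minimum over the empty
  set impose no restriction; these cases are excluded explicitly because of \<open>a / 0 = 0\<close>.
  The other denominators are positive.
\<close>

definition transport_time_step ::
  "boltzmann_data \<Rightarrow> mesh \<Rightarrow> quad_rule \<Rightarrow> real \<Rightarrow> real \<Rightarrow> real \<Rightarrow> real \<Rightarrow> real \<Rightarrow> real \<Rightarrow>
   nat \<Rightarrow> nat \<Rightarrow> nat \<Rightarrow> bool" where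
  "transport_time_step D T R t dt \<eta> s1 s2 s3 i k m \<longleftrightarrow>
     (let dx = face_x T i - face_x T (i - 1);
          dp = face_p T k - face_p T (k - 1);
          dmu = face_mu T m - face_mu T (m - 1);
          wN = weight R (npts R);
          max_de = Max ((\<lambda>r. denergy D (qnode R (face_p T (k - 1)) (face_p T k) r)) ` {1..npts R});
          max_E = Max ((\<lambda>r. \<bar>efield D (qnode R (face_x T (i - 1)) (face_x T i) r) t\<bar>) ` {1..npts R});
          max_mu = max \<bar>face_mu T (m - 1)\<bar> \<bar>face_mu T m\<bar>;
          max_sin = max (1 - (face_mu T (m - 1))\<^sup>2) (1 - (face_mu T m)\<^sup>2)
      in dt \<le> \<eta> * s1 * wN * dx / (max_de * max_mu) \<and>
         (charge D * max_E * max_mu \<noteq> 0 \<longrightarrow>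
            dt \<le> \<eta> * s2 * wN * dp / (charge D * max_E * max_mu)) \<and>
         (charge D * max_E * max_sin \<noteq> 0 \<longrightarrow>
            dt \<le> \<eta> * s3 * wN * dmu * face_p T (k - 1) / (charge D * max_E * max_sin)))"

definition loss_time_step ::
  "boltzmann_data \<Rightarrow> mesh \<Rightarrow> quad_rule \<Rightarrow> real \<Rightarrow> real \<Rightarrow> nat \<Rightarrow> bool" where
  "loss_time_step D T Gp dt \<eta> k \<longleftrightarrow>
     dt < (1 - \<eta>) /
       Max ((\<lambda>r. loss_rate D (qnode Gp (face_p T (k - 1)) (face_p T k) r)) ` {1..npts Gp})"

definition collision_time_step ::
  "boltzmann_data \<Rightarrow> mesh \<Rightarrow> quad_rule \<Rightarrow> quad_rule \<Rightarrow> quad_rule \<Rightarrow> quad_rule \<Rightarrow>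
   dg_function \<Rightarrow> real \<Rightarrow> real \<Rightarrow> nat \<Rightarrow> nat \<Rightarrow> nat \<Rightarrow> bool" where
  "collision_time_step D T Gx Gp Gm A f dt \<eta> i k m \<longleftrightarrow>
     (let Q = collision D A (val f);
          Z = {z \<in> cell_nodes T Gx Gp Gm i k m. Q z < 0}
      in Z \<noteq> {} \<longrightarrow> dt \<le> (1 - \<eta>) * Min ((\<lambda>z. val f z / \<bar>Q z\<bar>) ` Z))"

end

theory Submission
  imports Defs
begin

text \<open>
  Both parts are quadratures with positive weights of pointwise nonnegative quantities.
  In the transport part, the Gauss-Lobatto rule in the coordinate normal to a pair of faces
  already contains the interior traces at these faces with weight \<open>w\<^sub>N\<close>. Upwinding makes the
  exterior traces contribute with the good sign, and a share \<open>s\<close> of the cell average absorbs the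
  interior ones by the time-step restriction. In the collision part the rule is applied to
  \<open>f + \<Delta>t / (1 - \<eta>) Q(f)\<close>, where either the gain is nonnegative and the loss is controlled by the
  time step, or \<open>Q(f)\<close> is controlled directly.
\<close>

section \<open>Quadrature\<close>

lemma quad_add: "quad R a b (\<lambda>y. g y + h y) = quad R a b g + quad R a b h"
  by (simp add: quad_def sum.distrib algebra_simps)

lemma quad_cmult: "quad R a b (\<lambda>y. c * g y) = c * quad R a b g"
  by (simp add: quad_def sum_distrib_left mult_ac)

text \<open>Discrete Fubini: both sides are finite double sums. It allows the coordinate normal to a
  pair of faces to be summed innermost.\<close>

lemma quad_commute:
  "quad R a b (\<lambda>x. quad S c d (h x)) = quad S c d (\<lambda>y. quad R a b (\<lambda>x. h x y))"
  by (simp add: quad_def sum_distrib_left mult_ac, subst sum.swap, simp)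

lemma quad_mono:
  assumes "positive_rule R" "a \<le> b"
    and "\<And>j. j \<in> {1..npts R} \<Longrightarrow> g (qnode R a b j) \<le> h (qnode R a b j)"
  shows "quad R a b g \<le> quad R a b h"
  using assms unfolding quad_def positive_rule_def
  by (intro mult_left_mono sum_mono) (auto intro: less_imp_le)

lemma quad_nonneg:
  assumes "positive_rule R" "a \<le> b"
    and "\<And>j. j \<in> {1..npts R} \<Longrightarrow> 0 \<le> g (qnode R a b j)"
  shows "0 \<le> quad R a b g"
  using quad_mono[OF assms(1,2), of "\<lambda>_. 0" g] assms(3) by (simp add: quad_def)

text \<open>Reduces the transport estimate for one direction to fixed nodes of the two coordinates
  tangential to the faces.\<close>

lemma quad_quad_mono_scaled:
  assumes "positive_rule R" "a \<le> b" "positive_rule S" "c \<le> d"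
    and "\<And>j l. j \<in> {1..npts R} \<Longrightarrow> l \<in> {1..npts S} \<Longrightarrow>
           \<tau> * g (qnode R a b j) (qnode S c d l) \<le> s * h (qnode R a b j) (qnode S c d l)"
  shows "\<tau> * quad R a b (\<lambda>x. quad S c d (g x)) \<le> s * quad R a b (\<lambda>x. quad S c d (h x))"
  unfolding quad_cmult[symmetric] using assms by (intro quad_mono) auto

lemma qnode_in_Icc:
  assumes "positive_rule R" "a \<le> b" "j \<in> {1..npts R}"
  shows "qnode R a b j \<in> {a..b}"
proof -
  have n: "0 \<le> node R j" "node R j \<le> 1" using assms by (auto simp: positive_rule_def)
  then have "0 \<le> (b - a) * node R j" "(b - a) * node R j \<le> (b - a) * 1"
    using assms(2) by (intro mult_nonneg_nonneg mult_left_mono; simp)+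
  then show ?thesis by (auto simp: qnode_def)
qed

lemma gauss_qnode_in_Ioo:
  assumes "gauss_rule R" "a < b" "j \<in> {1..npts R}"
  shows "qnode R a b j \<in> {a<..<b}"
proof -
  have n: "0 < node R j" "node R j < 1" using assms by (auto simp: gauss_rule_def)
  then have "0 < (b - a) * node R j" "(b - a) * node R j < (b - a) * 1"
    using assms(2) by (intro mult_pos_pos mult_strict_left_mono; simp)+
  then show ?thesis by (auto simp: qnode_def)
qed

lemma lobatto_qnode_ends:
  assumes "gauss_lobatto_rule R"
  shows "qnode R a b 1 = a" "qnode R a b (npts R) = b"
  using assms by (auto simp: gauss_lobatto_rule_def qnode_def)

text \<open>All terms of the sum are nonnegative, so those at interior nodes may be dropped; the two
  that remain carry equal weights.\<close>

lemma lobatto_ends_le_quad: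
  assumes R: "gauss_lobatto_rule R" and "a \<le> b"
    and g: "\<And>j. j \<in> {1..npts R} \<Longrightarrow> 0 \<le> g (qnode R a b j)"
  shows "weight R (npts R) * (b - a) * (g a + g b) \<le> quad R a b g"
proof -
  let ?h = "\<lambda>j. weight R j * g (qnode R a b j)"
  have N: "2 \<le> npts R" "weight R 1 = weight R (npts R)"
    and pos: "positive_rule R" using R by (auto simp: gauss_lobatto_rule_def)
  have "sum ?h {1, npts R} \<le> sum ?h {1..npts R}"
    using N g pos by (intro sum_mono2) (auto simp: positive_rule_def intro!: mult_nonneg_nonneg dest: less_imp_le)
  \<comment> \<open>\<open>2 \<le> npts R\<close> makes the two end indices distinct, so both values
    are counted.\<close>
  moreover have "sum ?h {1, npts R} = weight R (npts R) * (g a + g b)"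
    using N lobatto_qnode_ends[OF R, of a b] by (simp add: algebra_simps)
  ultimately have "(b - a) * (weight R (npts R) * (g a + g b)) \<le> quad R a b g"
    using assms(2) unfolding quad_def by (intro mult_left_mono) auto
  then show ?thesis by (simp add: mult_ac)
qed

lemma tensor_quad_add:
  "tensor_quad Rx Rp Rm T i k m (\<lambda>z. g z + h z) =
     tensor_quad Rx Rp Rm T i k m g + tensor_quad Rx Rp Rm T i k m h"
  by (simp add: tensor_quad_def quad_add)

lemma tensor_quad_cmult:
  "tensor_quad Rx Rp Rm T i k m (\<lambda>z. c * g z) = c * tensor_quad Rx Rp Rm T i k m g"
  by (simp add: tensor_quad_def quad_cmult)

section \<open>The mesh\<close>

lemma partition_of_step:
  assumes "partition_of a b n F" "i \<in> {1..n}"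
  shows "F (i - 1) < F i"
  using assms by (cases i) (auto simp: partition_of_def)

lemma partition_of_le:
  assumes "partition_of a b n F" "i \<le> j" "j \<le> n"
  shows "F i \<le> F j"
  using assms(2,3)
proof (induction j rule: dec_induct)
  case (step j)
  then have "F j < F (Suc j)" using assms(1) by (simp add: partition_of_def)
  then show ?case using step by simp
qed simp

lemma partition_of_bounds:
  assumes "partition_of a b n F" "i \<le> n"
  shows "a \<le> F i" "F i \<le> b"
  using partition_of_le[OF assms(1), of 0 i] partition_of_le[OF assms(1), of i n] assms
  by (auto simp: partition_of_def)

lemma cell_faces:
  assumes "mesh_of D T" "cell_index T i k m"
  shows "face_x T (i - 1) < face_x T i" "face_p T (k - 1) < face_p T k"
    "face_mu T (m - 1) < face_mu T m" "0 \<le> face_p T (k - 1)" "face_p T k \<le> pmax D"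
    "-1 \<le> face_mu T (m - 1)" "face_mu T m \<le> 1"
proof -
  have "partition_of 0 (length_x D) (cells_x T) (face_x T)"
    "partition_of 0 (pmax D) (cells_p T) (face_p T)"
    "partition_of (-1) 1 (cells_mu T) (face_mu T)"
    using assms(1) by (auto simp: mesh_of_def)
  note P = this
  show "face_x T (i - 1) < face_x T i" "face_p T (k - 1) < face_p T k"
    "face_mu T (m - 1) < face_mu T m" "0 \<le> face_p T (k - 1)" "face_p T k \<le> pmax D"
    "-1 \<le> face_mu T (m - 1)" "face_mu T m \<le> 1"
    using assms(2) partition_of_step[OF P(1)] partition_of_step[OF P(2)] partition_of_step[OF P(3)]
      partition_of_bounds[OF P(2)] partition_of_bounds[OF P(3)]
    by (auto simp: cell_index_def)
qed

text \<open>The volume enters only through the factor \<open>1 / cell_volume T i k m\<close>, so its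
  sign is what matters. A non-integrable integrand would have integral 0 by convention.\<close>

lemma cell_volume_nonneg: "0 \<le> cell_volume T i k m"
proof (cases "(\<lambda>(x, p, \<mu>). p\<^sup>2 :: real) integrable_on cell T i k m")
  case True
  then show ?thesis unfolding cell_volume_def by (rule integral_nonneg) auto
next
  case False
  then show ?thesis unfolding cell_volume_def by (simp add: not_integrable_integral)
qed

text \<open>The average is built from \<open>piece\<close> and the collision operator from
  \<open>val\<close>, and these are tied together in cell interiors only. Gauss nodes lie strictly
  inside, so both can be evaluated there alike.\<close>

lemma cell_nodes_interior:
  assumes "mesh_of D T" "cell_index T i k m"
    and "gauss_rule Gx" "gauss_rule Gp" "gauss_rule Gm"
    and "z \<in> cell_nodes T Gx Gp Gm i k m"
  shows "z \<in> interior (cell T i k m)"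
  using assms(6) cell_faces[OF assms(1,2)] gauss_qnode_in_Ioo[OF assms(3)]
    gauss_qnode_in_Ioo[OF assms(4)] gauss_qnode_in_Ioo[OF assms(5)]
  unfolding cell_nodes_def cell_def interior_Times by (auto simp: interior_atLeastAtMost_real)

lemma tensor_quad_nonneg:
  assumes "mesh_of D T" "cell_index T i k m"
    and "positive_rule Rx" "positive_rule Rp" "positive_rule Rm"
    and "\<And>z. z \<in> cell_nodes T Rx Rp Rm i k m \<Longrightarrow> 0 \<le> g z"
  shows "0 \<le> tensor_quad Rx Rp Rm T i k m g"
  unfolding tensor_quad_def
  using cell_faces[OF assms(1,2)] assms
  by (intro quad_nonneg) (auto simp: cell_nodes_def)

section \<open>The energy band\<close>

lemma energy_has_derivative:
  assumes "boltzmann_model D" "p \<in> {0..pmax D}"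
  shows "(energy D has_real_derivative denergy D p) (at p within {0..pmax D})"
  using assms unfolding boltzmann_model_def denergy_def differentiable_on_def
    has_real_derivative_iff_has_vector_derivative
  by (auto simp: vector_derivative_works)

lemma continuous_on_energy:
  assumes "boltzmann_model D"
  shows "continuous_on {0..pmax D} (energy D)"
  using assms by (auto simp: boltzmann_model_def intro: differentiable_imp_continuous_on)

text \<open>The derivative may vanish at 0, so the criterion used asks for a positive derivative on
  the open interval only, with continuity up to its ends.\<close>

lemma energy_strict_mono:
  assumes D: "boltzmann_model D" and "0 \<le> p" "p < r" "r \<le> pmax D"
  shows "energy D p < energy D r"
proof (rule DERIV_pos_imp_increasing_open[OF \<open>p < r\<close>])
  fix x assume x: "p < x" "x < r"
  then have "0 < x" "x < pmax D" using assms by auto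
  then have "(energy D has_real_derivative denergy D x) (at x)" "0 < denergy D x"
    using energy_has_derivative[OF D, of x] D at_within_Icc_at[of 0 x "pmax D"]
    by (auto simp: boltzmann_model_def)
  then show "\<exists>y. (energy D has_real_derivative y) (at x) \<and> 0 < y" by blast
next
  show "continuous_on {p..r} (energy D)"
    using continuous_on_energy[OF D] by (rule continuous_on_subset) (use assms in auto)
qed

lemma inj_on_energy:
  assumes "boltzmann_model D"
  shows "inj_on (energy D) {0..pmax D}"
proof (rule linorder_inj_onI)
  fix p r assume "p < r" "p \<in> {0..pmax D}" "r \<in> {0..pmax D}"
  then show "energy D p \<noteq> energy D r" using energy_strict_mono[OF assms, of p r] by auto
qed auto

lemma energy_image:
  assumes D: "boltzmann_model D"
  shows "energy D ` {0..pmax D} = {0..emax D}"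
proof (intro equalityI subsetI)
  fix e assume "e \<in> energy D ` {0..pmax D}"
  then obtain p where p: "0 \<le> p" "p \<le> pmax D" "e = energy D p" by auto
  have z: "energy D 0 = 0" using D by (simp add: boltzmann_model_def)
  show "e \<in> {0..emax D}"
    using energy_strict_mono[OF D, of 0 p] energy_strict_mono[OF D, of p "pmax D"] p z
    by (cases "p = 0"; cases "p = pmax D") (auto simp: emax_def)
next
  fix e assume e: "e \<in> {0..emax D}"
  have "\<exists>p\<ge>0. p \<le> pmax D \<and> energy D p = e"
    by (rule IVT') (use e D continuous_on_energy[OF D] in \<open>auto simp: boltzmann_model_def emax_def\<close>)
  then show "e \<in> energy D ` {0..pmax D}" by auto
qed

lemma energy_momentum:
  assumes "boltzmann_model D" "e \<in> {0..emax D}"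
  shows "momentum D e \<in> {0..pmax D}" "energy D (momentum D e) = e"
  using assms(2) unfolding energy_image[OF assms(1), symmetric] momentum_def
  by (fact inv_into_into, fact f_inv_into_f)

lemma momentum_energy:
  assumes "boltzmann_model D" "p \<in> {0..pmax D}"
  shows "momentum D (energy D p) = p"
  unfolding momentum_def by (rule inv_into_f_f[OF inj_on_energy[OF assms(1)] assms(2)])

text \<open>A continuous injection on a compact set has a continuous inverse.\<close>

lemma continuous_on_momentum:
  assumes "boltzmann_model D"
  shows "continuous_on {0..emax D} (momentum D)"
  using continuous_on_inv[OF continuous_on_energy[OF assms] compact_Icc, of "momentum D"]
    momentum_energy[OF assms] by (auto simp: energy_image[OF assms])

text \<open>The inverse function rule, one-sided at \<open>emax D\<close>: the difference quotient
  of the inverse at \<open>e\<close> is the reciprocal of that of the energy at p(e). For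
  \<open>0 < e\<close> the point p(e) is not 0, so the energy has a positive derivative
  there.\<close>

lemma dmomentum_pos:
  assumes D: "boltzmann_model D" and e: "0 < e" "e \<le> emax D"
  shows "0 < dmomentum D e"
proof -
  define p where "p = momentum D e"
  have p: "p \<in> {0..pmax D}" "energy D p = e"
    using energy_momentum[OF D, of e] e by (auto simp: p_def)
  have "p \<noteq> 0" using p e D by (auto simp: boltzmann_model_def)
  then have dp: "0 < denergy D p" using p D by (auto simp: boltzmann_model_def)
  let ?F = "at e within {0..emax D}"
  \<comment> \<open>To be substituted into the limit of the difference quotient at \<open>p\<close>,
    \<open>momentum D y\<close> must tend to \<open>p\<close> without attaining it. The former is
    continuity, the latter injectivity.\<close>
  have "filterlim (momentum D) (at p within {0..pmax D}) ?F"
    unfolding filterlim_at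
  proof
    show "(momentum D \<longlongrightarrow> p) ?F"
      using continuous_on_momentum[OF D] e by (auto simp: continuous_on_def p_def)
    show "\<forall>\<^sub>F y in ?F. momentum D y \<in> {0..pmax D} \<and> momentum D y \<noteq> p"
      unfolding eventually_at_filter
    proof (rule always_eventually, intro allI impI)
      fix y assume "y \<noteq> e" "y \<in> {0..emax D}"
      then show "momentum D y \<in> {0..pmax D} \<and> momentum D y \<noteq> p"
        using energy_momentum[OF D, of y] p by auto
    qed
  qed
  moreover have Q: "((\<lambda>r. (energy D r - energy D p) / (r - p)) \<longlongrightarrow> denergy D p)
      (at p within {0..pmax D})"
    using energy_has_derivative[OF D p(1)] by (simp add: has_field_derivative_iff)
  ultimately have "((\<lambda>y. (energy D (momentum D y) - energy D p) / (momentum D y - p))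
      \<longlongrightarrow> denergy D p) ?F"
    using filterlim_compose[OF Q] by blast
  then have "((\<lambda>y. inverse ((energy D (momentum D y) - energy D p) / (momentum D y - p)))
      \<longlongrightarrow> inverse (denergy D p)) ?F"
    by (rule tendsto_inverse) (use dp in simp)
  then have "((\<lambda>y. (momentum D y - momentum D e) / (y - e)) \<longlongrightarrow> inverse (denergy D p)) ?F"
  proof (rule Lim_transform_eventually)
    show "\<forall>\<^sub>F y in ?F. inverse ((energy D (momentum D y) - energy D p) / (momentum D y - p)) =
        (momentum D y - momentum D e) / (y - e)"
      unfolding eventually_at_filter
    proof (rule always_eventually, intro allI impI)
      fix y assume "y \<in> {0..emax D}"
      then show "inverse ((energy D (momentum D y) - energy D p) / (momentum D y - p)) =
          (momentum D y - momentum D e) / (y - e)"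
        using energy_momentum(2)[OF D, of y] p(2) by (simp add: p_def)
    qed
  qed
  then have "(momentum D has_vector_derivative inverse (denergy D p)) ?F"
    by (simp add: has_field_derivative_iff flip: has_real_derivative_iff_has_vector_derivative)
  \<comment> \<open>The derivative within a nondegenerate closed interval is unique, so the one
    found is the one chosen by \<open>vector_derivative\<close>.\<close>
  then have "dmomentum D e = inverse (denergy D p)"
    unfolding dmomentum_def
    by (rule vector_derivative_within_closed_interval[rotated 2]) (use e in auto)
  then show ?thesis using dp by simp
qed

lemma density_factor_nonneg:
  assumes D: "boltzmann_model D"
  shows "0 \<le> density_factor D e"
proof (cases "0 < e \<and> e \<le> emax D")
  case True
  then show ?thesis using dmomentum_pos[OF D] by (auto simp: density_factor_def less_imp_le)
next
  case False
  \<comment> \<open>\<open>dmomentum\<close> may be a junk value at \<open>0\<close>, where \<open>p(\<epsilon>)\<^sup>2 = 0\<close>.\<close>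
  have "momentum D 0 = 0"
    using momentum_energy[OF D, of 0] D by (auto simp: boltzmann_model_def)
  then show ?thesis using False by (cases "e = 0") (auto simp: density_factor_def indicator_def)
qed

section \<open>The transport part\<close>

text \<open>The scalar upwind flux with normal velocity \<open>\<alpha>\<close>, trace
  \<open>u\<close> from the lower and \<open>v\<close> from the upper side. The three fluxes are
  instances with velocities proportional to \<mu>, -E\<mu> and -E.\<close>

definition upwind :: "real \<Rightarrow> real \<Rightarrow> real \<Rightarrow> real" where
  "upwind \<alpha> u v = (\<alpha> + \<bar>\<alpha>\<bar>) / 2 * u + (\<alpha> - \<bar>\<alpha>\<bar>) / 2 * v"

lemma flux_upwind:
  "flux_x D T f i k m p \<mu> =
     denergy D p * upwind \<mu> (piece f i k m (face_x T i, p, \<mu>)) (piece f (i + 1) k m (face_x T i, p, \<mu>))"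
  "flux_p D T f t i k m x \<mu> =
     charge D * upwind (- (efield D x t * \<mu>))
       (piece f i k m (x, face_p T k, \<mu>)) (piece f i (k + 1) m (x, face_p T k, \<mu>))"
  "flux_mu D T f t i k m x p =
     charge D * upwind (- efield D x t)
       (piece f i k m (x, p, face_mu T m)) (piece f i k (m + 1) (x, p, face_mu T m))"
  by (simp_all add: flux_x_def flux_p_def flux_mu_def upwind_def field_simps)

text \<open>One of the two terms always vanishes; what remains has the sign of
  \<open>\<alpha>\<close> because the traces are nonnegative.\<close>

lemma upwind_bounds:
  assumes "0 \<le> u" "0 \<le> v"
  shows "upwind \<alpha> u v \<le> \<bar>\<alpha>\<bar> * u" "- (\<bar>\<alpha>\<bar> * v) \<le> upwind \<alpha> u v"
proof -
  have "upwind \<alpha> u v = \<bar>\<alpha>\<bar> * u \<or> upwind \<alpha> u v = - (\<bar>\<alpha>\<bar> * v)"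
    by (cases "0 \<le> \<alpha>") (auto simp: upwind_def)
  moreover have "0 \<le> \<bar>\<alpha>\<bar> * u" "0 \<le> \<bar>\<alpha>\<bar> * v" using assms by auto
  ultimately show "upwind \<alpha> u v \<le> \<bar>\<alpha>\<bar> * u" "- (\<bar>\<alpha>\<bar> * v) \<le> upwind \<alpha> u v" by linarith+
qed

text \<open>
  \<open>u0\<close>, \<open>u1\<close> are the interior and \<open>v0\<close>, \<open>v1\<close> the exterior traces at the lower and upper face;
  there is no usable exterior trace where the geometric factor \<open>c\<close> vanishes.
\<close>

lemma upwind_jump_le:
  assumes "0 \<le> u0" "0 \<le> u1" "0 \<le> c0" "0 \<le> c1" "c0 \<noteq> 0 \<Longrightarrow> 0 \<le> v0" "c1 \<noteq> 0 \<Longrightarrow> 0 \<le> v1"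
  shows "c1 * upwind \<alpha> u1 v1 - c0 * upwind \<alpha> v0 u0 \<le> \<bar>\<alpha>\<bar> * (c0 * u0 + c1 * u1)"
proof -
  have "c1 * upwind \<alpha> u1 v1 \<le> c1 * (\<bar>\<alpha>\<bar> * u1)"
    using assms upwind_bounds(1)[of u1 v1 \<alpha>] by (cases "c1 = 0") (auto intro: mult_left_mono)
  moreover have "c0 * - (\<bar>\<alpha>\<bar> * u0) \<le> c0 * upwind \<alpha> v0 u0"
    using assms mult_left_mono[OF upwind_bounds(2)[of v0 u0 \<alpha>], of c0] by (cases "c0 = 0") auto
  ultimately show ?thesis by (simp add: algebra_simps)
qed

text \<open>The core of all three directions, at fixed tangential nodes: \<open>F\<close> is the
  flux difference, \<open>g\<close> the integrand of the average, \<open>\<tau>\<close> stands for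
  \<open>dt / \<eta>\<close> and \<open>s\<close> for the share of the average. The time step makes
  the end terms of the rule outweigh \<open>F\<close>.\<close>

lemma lobatto_absorbs:
  assumes R: "gauss_lobatto_rule R" and "a \<le> b" "0 \<le> s" "0 \<le> \<tau>"
    and g: "\<And>j. j \<in> {1..npts R} \<Longrightarrow> 0 \<le> g (qnode R a b j)"
    and F: "F \<le> \<kappa> * (g a + g b)" and step: "\<tau> * \<kappa> \<le> s * weight R (npts R) * (b - a)"
  shows "\<tau> * F \<le> s * quad R a b g"
proof -
  have "1 \<in> {1..npts R}" "npts R \<in> {1..npts R}" using R by (auto simp: gauss_lobatto_rule_def)
  then have nn: "0 \<le> g a + g b" using g[of 1] g[of "npts R"] lobatto_qnode_ends[OF R, of a b] by simp
  have "\<tau> * F \<le> \<tau> * (\<kappa> * (g a + g b))" using F \<open>0 \<le> \<tau>\<close> by (rule mult_left_mono)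
  also have "\<dots> = \<tau> * \<kappa> * (g a + g b)" by simp
  also have "\<dots> \<le> s * weight R (npts R) * (b - a) * (g a + g b)"
    using step nn by (rule mult_right_mono)
  also have "\<dots> = s * (weight R (npts R) * (b - a) * (g a + g b))" by simp
  also have "\<dots> \<le> s * quad R a b g"
    using lobatto_ends_le_quad[where g = g, OF R \<open>a \<le> b\<close> g] \<open>0 \<le> s\<close> by (rule mult_left_mono)
  finally show ?thesis .
qed

text \<open>The estimate at the x-faces has x innermost, while the tensor rule of the average has it
  outermost; two exchanges of sums connect them.\<close>

lemma quad_rotate:
  "quad P a b (\<lambda>p. quad M c d (\<lambda>\<mu>. quad X l r (\<lambda>x. g x p \<mu>))) =
     quad X l r (\<lambda>x. quad P a b (\<lambda>p. quad M c d (\<lambda>\<mu>. g x p \<mu>)))"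
proof -
  have "quad M c d (\<lambda>\<mu>. quad X l r (\<lambda>x. g x p \<mu>)) = quad X l r (\<lambda>x. quad M c d (\<lambda>\<mu>. g x p \<mu>))" for p
    by (rule quad_commute)
  then show ?thesis by (simp only:) (rule quad_commute)
qed

text \<open>A restriction cleared of its denominator. If the denominator vanishes, so does the
  left-hand side.\<close>

lemma time_step_bound:
  fixes \<eta> dt B K :: real
  assumes "0 < \<eta>" "0 \<le> K" "0 \<le> B" "K \<noteq> 0 \<Longrightarrow> dt \<le> \<eta> * B / K"
  shows "dt / \<eta> * K \<le> B"
  using assms by (cases "K = 0") (auto simp: field_simps)

section \<open>The transport balance of a single cell\<close>

locale lobatto_cell =
  fixes D :: boltzmann_data and T :: mesh and R :: quad_rule and f :: dg_function
    and t :: real and i k m :: nat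
  assumes model: "boltzmann_model D" and mesh: "mesh_of D T" and index: "cell_index T i k m"
    and lobatto: "gauss_lobatto_rule R" and traces: "lobatto_positive T R f i k m"
begin

abbreviation "xn \<equiv> qnode R (face_x T (i - 1)) (face_x T i)"
abbreviation "pn \<equiv> qnode R (face_p T (k - 1)) (face_p T k)"
abbreviation "\<mu>n \<equiv> qnode R (face_mu T (m - 1)) (face_mu T m)"
abbreviation "Ix \<equiv> quad R (face_x T (i - 1)) (face_x T i)"
abbreviation "Ip \<equiv> quad R (face_p T (k - 1)) (face_p T k)"
abbreviation "I\<mu> \<equiv> quad R (face_mu T (m - 1)) (face_mu T m)"
abbreviation "nodes \<equiv> {1..npts R}"
abbreviation "wN \<equiv> weight R (npts R)"
abbreviation "u \<equiv> piece f i k m"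

lemmas faces = cell_faces[OF mesh index]

lemma positive: "positive_rule R"
  using lobatto by (simp add: gauss_lobatto_rule_def)

lemma end_nodes: "1 \<in> nodes" "npts R \<in> nodes" "0 < wN"
  using lobatto by (auto simp: gauss_lobatto_rule_def positive_rule_def)

lemma index_pos: "1 \<le> i" "1 \<le> k" "1 \<le> m" "m \<le> cells_mu T"
  using index by (auto simp: cell_index_def)

lemma p_node: "b \<in> nodes \<Longrightarrow> face_p T (k - 1) \<le> pn b \<and> pn b \<le> face_p T k"
  using qnode_in_Icc[OF positive, of "face_p T (k - 1)" "face_p T k" b] faces by simp

lemma u_nonneg: "a \<in> nodes \<Longrightarrow> b \<in> nodes \<Longrightarrow> c \<in> nodes \<Longrightarrow> 0 \<le> u (xn a, pn b, \<mu>n c)"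
  using traces by (auto simp: lobatto_positive_def Let_def intro: less_imp_le)

text \<open>The interval ends are the first and the last Gauss-Lobatto node, so interior traces are
  nodal values.\<close>

lemma u_nonneg_faces:
  assumes "b \<in> nodes" "c \<in> nodes"
  shows "0 \<le> u (face_x T (i - 1), pn b, \<mu>n c)" "0 \<le> u (face_x T i, pn b, \<mu>n c)"
    "0 \<le> u (xn b, face_p T (k - 1), \<mu>n c)" "0 \<le> u (xn b, face_p T k, \<mu>n c)"
    "0 \<le> u (xn b, pn c, face_mu T (m - 1))" "0 \<le> u (xn b, pn c, face_mu T m)"
  using u_nonneg[of 1 b c] u_nonneg[of "npts R" b c] u_nonneg[of b 1 c] u_nonneg[of b "npts R" c]
    u_nonneg[of b c 1] u_nonneg[of b c "npts R"] assms end_nodes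
  unfolding lobatto_qnode_ends[OF lobatto] by simp_all

lemma exterior_nonneg:
  assumes "b \<in> nodes" "c \<in> nodes"
  shows "0 \<le> piece f (i - 1) k m (face_x T (i - 1), pn b, \<mu>n c)"
    "0 \<le> piece f (i + 1) k m (face_x T i, pn b, \<mu>n c)"
    "1 < k \<Longrightarrow> 0 \<le> piece f i (k - 1) m (xn b, face_p T (k - 1), \<mu>n c)"
    "0 \<le> piece f i (k + 1) m (xn b, face_p T k, \<mu>n c)"
    "1 < m \<Longrightarrow> 0 \<le> piece f i k (m - 1) (xn b, pn c, face_mu T (m - 1))"
    "m < cells_mu T \<Longrightarrow> 0 \<le> piece f i k (m + 1) (xn b, pn c, face_mu T m)"
  using traces assms unfolding lobatto_positive_def Let_def by (meson less_imp_le)+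

text \<open>These four maxima repeat the local ones in \<open>transport_time_step\<close>, so that
  the restrictions can be read in terms of them.\<close>

definition max_de :: real where "max_de = Max ((\<lambda>r. denergy D (pn r)) ` nodes)"
definition max_E :: real where "max_E = Max ((\<lambda>r. \<bar>efield D (xn r) t\<bar>) ` nodes)"
definition max_mu :: real where "max_mu = max \<bar>face_mu T (m - 1)\<bar> \<bar>face_mu T m\<bar>"
definition max_sin :: real where
  "max_sin = max (1 - (face_mu T (m - 1))\<^sup>2) (1 - (face_mu T m)\<^sup>2)"

lemma denergy_le: "b \<in> nodes \<Longrightarrow> denergy D (pn b) \<le> max_de"
  unfolding max_de_def by (intro Max_ge) auto

lemma efield_le: "a \<in> nodes \<Longrightarrow> \<bar>efield D (xn a) t\<bar> \<le> max_E"
  unfolding max_E_def by (intro Max_ge) auto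

lemma denergy_pos: "0 < p \<Longrightarrow> p \<le> face_p T k \<Longrightarrow> 0 < denergy D p"
  using model faces by (auto simp: boltzmann_model_def)

lemma max_de_pos: "0 < max_de"
proof -
  \<comment> \<open>The upper face has positive momentum even in the first cell, where the
    derivative may vanish at the lower face p = 0.\<close>
  have "0 < denergy D (face_p T k)" using faces by (intro denergy_pos) auto
  then show ?thesis
    using denergy_le[OF end_nodes(2)] lobatto_qnode_ends[OF lobatto] by simp
qed

lemma max_E_nonneg: "0 \<le> max_E"
  using efield_le[OF end_nodes(1)] by linarith

text \<open>Two distinct faces cannot both be \<mu> = 0.\<close>

lemma max_mu_pos: "0 < max_mu"
  using faces(3) unfolding max_mu_def by linarith

lemma abs_mu_le:
  assumes "c \<in> nodes"
  shows "\<bar>\<mu>n c\<bar> \<le> max_mu"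
proof -
  have "\<mu>n c \<in> {face_mu T (m - 1)..face_mu T m}"
    using assms faces by (intro qnode_in_Icc[OF positive]) auto
  then have "face_mu T (m - 1) \<le> \<mu>n c" "\<mu>n c \<le> face_mu T m" by simp_all
  then show ?thesis unfolding max_mu_def by linarith
qed

lemma geometric_nonneg: "0 \<le> 1 - (face_mu T (m - 1))\<^sup>2" "0 \<le> 1 - (face_mu T m)\<^sup>2"
  using faces by (simp_all add: abs_square_le_1)

lemma max_sin_nonneg: "0 \<le> max_sin"
  using geometric_nonneg unfolding max_sin_def by linarith

lemma charge_pos: "0 < charge D"
  using model by (simp add: boltzmann_model_def)

lemma transport_x:
  assumes "0 \<le> s" "0 \<le> \<tau>"
    and step: "\<tau> * (max_de * max_mu) \<le> s * wN * (face_x T i - face_x T (i - 1))"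
  shows "\<tau> * Ip (\<lambda>p. I\<mu> (\<lambda>\<mu>. (flux_x D T f i k m p \<mu> - flux_x D T f (i - 1) k m p \<mu>) * p\<^sup>2))
    \<le> s * Ix (\<lambda>x. Ip (\<lambda>p. I\<mu> (\<lambda>\<mu>. u (x, p, \<mu>) * p\<^sup>2)))"
proof -
  have pw: "\<tau> * ((flux_x D T f i k m p \<mu> - flux_x D T f (i - 1) k m p \<mu>) * p\<^sup>2)
      \<le> s * Ix (\<lambda>x. u (x, p, \<mu>) * p\<^sup>2)"
    if bc: "b \<in> nodes" "c \<in> nodes" and p: "p = pn b" and \<mu>: "\<mu> = \<mu>n c" for b c p \<mu>
  proof (cases "p = 0")
    \<comment> \<open>The node p = 0 occurs in the first momentum cell; the weight p^2 annihilates
      both sides.\<close>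
    case True
    then show ?thesis by (simp add: quad_def)
  next
    case False
    then have de: "0 < denergy D p"
      using p_node[OF bc(1)] faces p by (intro denergy_pos) auto
    show ?thesis
    proof (rule lobatto_absorbs[where \<kappa> = "denergy D p * \<bar>\<mu>\<bar>", OF lobatto])
      let ?u0 = "u (face_x T (i - 1), p, \<mu>)" and ?u1 = "u (face_x T i, p, \<mu>)"
      let ?v0 = "piece f (i - 1) k m (face_x T (i - 1), p, \<mu>)"
      let ?v1 = "piece f (i + 1) k m (face_x T i, p, \<mu>)"
      have "upwind \<mu> ?u1 ?v1 - upwind \<mu> ?v0 ?u0 \<le> \<bar>\<mu>\<bar> * (?u0 + ?u1)"
        using upwind_jump_le[of ?u0 ?u1 1 1 ?v0 ?v1 \<mu>] u_nonneg_faces(1,2)[OF bc]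
          exterior_nonneg(1,2)[OF bc] p \<mu> by simp
      then have "denergy D p * p\<^sup>2 * (upwind \<mu> ?u1 ?v1 - upwind \<mu> ?v0 ?u0)
          \<le> denergy D p * p\<^sup>2 * (\<bar>\<mu>\<bar> * (?u0 + ?u1))"
        by (rule mult_left_mono) (use de in simp)
      \<comment> \<open>In the flux through face \<open>i - 1\<close> the cell itself is on the
        upper side, since \<open>i - 1 + 1 = i\<close> for \<open>1 \<le> i\<close>. Its interior
        trace is thus the second one there.\<close>
      then show "(flux_x D T f i k m p \<mu> - flux_x D T f (i - 1) k m p \<mu>) * p\<^sup>2
          \<le> denergy D p * \<bar>\<mu>\<bar> * (?u0 * p\<^sup>2 + ?u1 * p\<^sup>2)"
        using index_pos by (simp add: flux_upwind algebra_simps)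
      have "denergy D p * \<bar>\<mu>\<bar> \<le> max_de * max_mu"
        using denergy_le[OF bc(1)] abs_mu_le[OF bc(2)] max_de_pos p \<mu> by (intro mult_mono) auto
      then show "\<tau> * (denergy D p * \<bar>\<mu>\<bar>) \<le> s * wN * (face_x T i - face_x T (i - 1))"
        by (rule order_trans[OF mult_left_mono[OF _ \<open>0 \<le> \<tau>\<close>] step])
      show "0 \<le> u (xn j, p, \<mu>) * p\<^sup>2" if "j \<in> nodes" for j
        using u_nonneg[OF that bc] p \<mu> by simp
    qed (use assms faces in auto)
  qed
  have "\<tau> * Ip (\<lambda>p. I\<mu> (\<lambda>\<mu>. (flux_x D T f i k m p \<mu> - flux_x D T f (i - 1) k m p \<mu>) * p\<^sup>2))
    \<le> s * Ip (\<lambda>p. I\<mu> (\<lambda>\<mu>. Ix (\<lambda>x. u (x, p, \<mu>) * p\<^sup>2)))"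
    by (rule quad_quad_mono_scaled[OF positive less_imp_le[OF faces(2)] positive less_imp_le[OF faces(3)]],
      rule pw[OF _ _ refl refl])
  then show ?thesis by (subst (asm) quad_rotate)
qed

text \<open>The geometric factor p^2 at the faces is the weight of the average, so the interior
  traces appear exactly as end values of the integrand.\<close>

lemma transport_p:
  assumes "0 \<le> s" "0 \<le> \<tau>"
    and step: "\<tau> * (charge D * max_E * max_mu) \<le> s * wN * (face_p T k - face_p T (k - 1))"
  shows "\<tau> * Ix (\<lambda>x. I\<mu> (\<lambda>\<mu>. (face_p T k)\<^sup>2 * flux_p D T f t i k m x \<mu> -
                              (face_p T (k - 1))\<^sup>2 * flux_p D T f t i (k - 1) m x \<mu>))
    \<le> s * Ix (\<lambda>x. Ip (\<lambda>p. I\<mu> (\<lambda>\<mu>. u (x, p, \<mu>) * p\<^sup>2)))"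
proof -
  have pw: "\<tau> * ((face_p T k)\<^sup>2 * flux_p D T f t i k m x \<mu> -
        (face_p T (k - 1))\<^sup>2 * flux_p D T f t i (k - 1) m x \<mu>)
      \<le> s * Ip (\<lambda>p. u (x, p, \<mu>) * p\<^sup>2)"
    if ac: "a \<in> nodes" "c \<in> nodes" and x: "x = xn a" and \<mu>: "\<mu> = \<mu>n c" for a c x \<mu>
  proof (rule lobatto_absorbs[where \<kappa> = "charge D * \<bar>efield D x t * \<mu>\<bar>", OF lobatto])
    let ?u0 = "u (x, face_p T (k - 1), \<mu>)" and ?u1 = "u (x, face_p T k, \<mu>)"
    let ?v0 = "piece f i (k - 1) m (x, face_p T (k - 1), \<mu>)"
    let ?v1 = "piece f i (k + 1) m (x, face_p T k, \<mu>)"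
    let ?\<alpha> = "- (efield D x t * \<mu>)"
    \<comment> \<open>The lower face of the first cell is p = 0, where no exterior trace is
      available.\<close>
    have "k = 1 \<Longrightarrow> (face_p T (k - 1))\<^sup>2 = 0"
      using mesh by (simp add: mesh_of_def partition_of_def)
    then have "(face_p T (k - 1))\<^sup>2 \<noteq> 0 \<Longrightarrow> 1 < k" using index_pos by linarith
    then have "(face_p T k)\<^sup>2 * upwind ?\<alpha> ?u1 ?v1 - (face_p T (k - 1))\<^sup>2 * upwind ?\<alpha> ?v0 ?u0
        \<le> \<bar>?\<alpha>\<bar> * ((face_p T (k - 1))\<^sup>2 * ?u0 + (face_p T k)\<^sup>2 * ?u1)"
      using u_nonneg_faces(3,4)[OF ac] exterior_nonneg(3,4)[OF ac] x \<mu>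
      by (intro upwind_jump_le) auto
    then have "charge D * ((face_p T k)\<^sup>2 * upwind ?\<alpha> ?u1 ?v1 -
          (face_p T (k - 1))\<^sup>2 * upwind ?\<alpha> ?v0 ?u0)
        \<le> charge D * (\<bar>?\<alpha>\<bar> * ((face_p T (k - 1))\<^sup>2 * ?u0 + (face_p T k)\<^sup>2 * ?u1))"
      by (rule mult_left_mono) (use charge_pos in simp)
    then show "(face_p T k)\<^sup>2 * flux_p D T f t i k m x \<mu> -
          (face_p T (k - 1))\<^sup>2 * flux_p D T f t i (k - 1) m x \<mu>
        \<le> charge D * \<bar>efield D x t * \<mu>\<bar> * (?u0 * (face_p T (k - 1))\<^sup>2 + ?u1 * (face_p T k)\<^sup>2)"
      using index_pos by (simp add: flux_upwind algebra_simps)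
    have "\<bar>efield D x t\<bar> * \<bar>\<mu>\<bar> \<le> max_E * max_mu"
      using efield_le[OF ac(1)] abs_mu_le[OF ac(2)] max_E_nonneg x \<mu> by (intro mult_mono) auto
    then have "charge D * \<bar>efield D x t * \<mu>\<bar> \<le> charge D * max_E * max_mu"
      using charge_pos by (simp add: abs_mult mult.assoc)
    then show "\<tau> * (charge D * \<bar>efield D x t * \<mu>\<bar>)
        \<le> s * wN * (face_p T k - face_p T (k - 1))"
      by (rule order_trans[OF mult_left_mono[OF _ \<open>0 \<le> \<tau>\<close>] step])
    show "0 \<le> u (x, pn j, \<mu>) * (pn j)\<^sup>2" if "j \<in> nodes" for j
      using u_nonneg[OF ac(1) that ac(2)] x \<mu> by simp
  qed (use assms faces in auto)
  have "\<tau> * Ix (\<lambda>x. I\<mu> (\<lambda>\<mu>. (face_p T k)\<^sup>2 * flux_p D T f t i k m x \<mu> -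
        (face_p T (k - 1))\<^sup>2 * flux_p D T f t i (k - 1) m x \<mu>))
      \<le> s * Ix (\<lambda>x. I\<mu> (\<lambda>\<mu>. Ip (\<lambda>p. u (x, p, \<mu>) * p\<^sup>2)))"
    by (rule quad_quad_mono_scaled[OF positive less_imp_le[OF faces(1)] positive less_imp_le[OF faces(3)]],
      rule pw[OF _ _ refl refl])
  moreover have "I\<mu> (\<lambda>\<mu>. Ip (\<lambda>p. u (x, p, \<mu>) * p\<^sup>2)) = Ip (\<lambda>p. I\<mu> (\<lambda>\<mu>. u (x, p, \<mu>) * p\<^sup>2))" for x
    by (rule quad_commute)
  ultimately show ?thesis by simp
qed

text \<open>The flux carries the weight p but the average p^2, which leaves a factor 1/p in
  \<open>\<kappa>\<close>; the bound \<open>face_p T (k - 1) \<le> p\<close> controls it.\<close>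

lemma transport_mu:
  assumes "0 \<le> s" "0 \<le> \<tau>"
    and step: "\<tau> * (charge D * max_E * max_sin)
      \<le> s * wN * (face_mu T m - face_mu T (m - 1)) * face_p T (k - 1)"
  shows "\<tau> * Ix (\<lambda>x. Ip (\<lambda>p. ((1 - (face_mu T m)\<^sup>2) * flux_mu D T f t i k m x p -
                              (1 - (face_mu T (m - 1))\<^sup>2) * flux_mu D T f t i k (m - 1) x p) * p))
    \<le> s * Ix (\<lambda>x. Ip (\<lambda>p. I\<mu> (\<lambda>\<mu>. u (x, p, \<mu>) * p\<^sup>2)))"
proof -
  let ?c1 = "1 - (face_mu T m)\<^sup>2" and ?c0 = "1 - (face_mu T (m - 1))\<^sup>2"
  have pw: "\<tau> * ((?c1 * flux_mu D T f t i k m x p - ?c0 * flux_mu D T f t i k (m - 1) x p) * p)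
      \<le> s * I\<mu> (\<lambda>\<mu>. u (x, p, \<mu>) * p\<^sup>2)"
    if ab: "a \<in> nodes" "b \<in> nodes" and x: "x = xn a" and pb: "p = pn b" for a b x p
  proof (cases "p = 0")
    case True
    then show ?thesis by (simp add: quad_def)
  next
    case False
    then have p: "0 < p" "face_p T (k - 1) \<le> p" using p_node[OF ab(2)] faces pb by auto
    show ?thesis
    proof (rule lobatto_absorbs[where \<kappa> = "charge D * \<bar>efield D x t\<bar> * max_sin / p", OF lobatto])
      let ?u0 = "u (x, p, face_mu T (m - 1))" and ?u1 = "u (x, p, face_mu T m)"
      let ?v0 = "piece f i k (m - 1) (x, p, face_mu T (m - 1))"
      let ?v1 = "piece f i k (m + 1) (x, p, face_mu T m)"
      let ?\<alpha> = "- efield D x t"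
      \<comment> \<open>The outermost faces are \<mu> = -1 and \<mu> = 1, so only traces from
        existing neighbours are asked for.\<close>
      have "m = 1 \<Longrightarrow> ?c0 = 0" "m = cells_mu T \<Longrightarrow> ?c1 = 0"
        using mesh by (simp_all add: mesh_of_def partition_of_def)
      then have "?c0 \<noteq> 0 \<Longrightarrow> 1 < m" "?c1 \<noteq> 0 \<Longrightarrow> m < cells_mu T" using index_pos by linarith+
      then have "?c1 * upwind ?\<alpha> ?u1 ?v1 - ?c0 * upwind ?\<alpha> ?v0 ?u0
          \<le> \<bar>?\<alpha>\<bar> * (?c0 * ?u0 + ?c1 * ?u1)"
        using u_nonneg_faces(5,6)[OF ab] exterior_nonneg(5,6)[OF ab] x pb geometric_nonneg
        by (intro upwind_jump_le) auto
      \<comment> \<open>The geometric factors of the two faces differ, but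
        \<open>lobatto_absorbs\<close> needs one constant for both.\<close>
      also have "\<dots> \<le> \<bar>?\<alpha>\<bar> * (max_sin * ?u0 + max_sin * ?u1)"
        using u_nonneg_faces(5,6)[OF ab] x pb
        by (intro mult_left_mono add_mono mult_right_mono) (auto simp: max_sin_def)
      finally have "charge D * p * (?c1 * upwind ?\<alpha> ?u1 ?v1 - ?c0 * upwind ?\<alpha> ?v0 ?u0)
          \<le> charge D * p * (\<bar>?\<alpha>\<bar> * (max_sin * ?u0 + max_sin * ?u1))"
        by (rule mult_left_mono) (use charge_pos p in simp)
      moreover have "(?c1 * flux_mu D T f t i k m x p - ?c0 * flux_mu D T f t i k (m - 1) x p) * p
          = charge D * p * (?c1 * upwind ?\<alpha> ?u1 ?v1 - ?c0 * upwind ?\<alpha> ?v0 ?u0)"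
        using index_pos by (simp add: flux_upwind algebra_simps)
      moreover have "charge D * \<bar>efield D x t\<bar> * max_sin / p * (?u0 * p\<^sup>2 + ?u1 * p\<^sup>2)
          = charge D * p * (\<bar>?\<alpha>\<bar> * (max_sin * ?u0 + max_sin * ?u1))"
        using p by (simp add: field_simps power2_eq_square)
      ultimately show "(?c1 * flux_mu D T f t i k m x p - ?c0 * flux_mu D T f t i k (m - 1) x p) * p
          \<le> charge D * \<bar>efield D x t\<bar> * max_sin / p * (?u0 * p\<^sup>2 + ?u1 * p\<^sup>2)"
        by (simp only:)
      let ?B = "s * wN * (face_mu T m - face_mu T (m - 1))"
      have "charge D * \<bar>efield D x t\<bar> * max_sin \<le> charge D * max_E * max_sin"
        using efield_le[OF ab(1)] charge_pos max_sin_nonneg x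
        by (intro mult_right_mono mult_left_mono) auto
      then have "\<tau> * (charge D * \<bar>efield D x t\<bar> * max_sin) \<le> ?B * face_p T (k - 1)"
        by (rule order_trans[OF mult_left_mono[OF _ \<open>0 \<le> \<tau>\<close>] step])
      also have "\<dots> \<le> ?B * p"
        using p assms(1) end_nodes faces by (intro mult_left_mono) auto
      finally show "\<tau> * (charge D * \<bar>efield D x t\<bar> * max_sin / p) \<le> ?B"
        using p by (simp add: field_simps)
      show "0 \<le> u (x, p, \<mu>n j) * p\<^sup>2" if "j \<in> nodes" for j
        using u_nonneg[OF ab that] x pb by simp
    qed (use assms faces in auto)
  qed
  show ?thesis by (rule quad_quad_mono_scaled[OF positive less_imp_le[OF faces(1)] positive less_imp_le[OF faces(2)]],
      rule pw[OF _ _ refl refl])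
qed

lemma transport_part_nonneg:
  assumes exact: "exact_for_average R R R T f i k m"
    and dt: "0 < dt" and \<eta>: "0 < \<eta>"
    and s: "0 < s1" "0 < s2" "0 < s3" "s1 + s2 + s3 = 1"
    and step: "transport_time_step D T R t dt \<eta> s1 s2 s3 i k m"
  shows "0 \<le> transport_part D T R f t dt \<eta> i k m"
proof -
  let ?dx = "face_x T i - face_x T (i - 1)" and ?dp = "face_p T k - face_p T (k - 1)"
    and ?dm = "face_mu T m - face_mu T (m - 1)"
  have st: "dt \<le> \<eta> * s1 * wN * ?dx / (max_de * max_mu)"
    "charge D * max_E * max_mu \<noteq> 0 \<Longrightarrow> dt \<le> \<eta> * s2 * wN * ?dp / (charge D * max_E * max_mu)"
    "charge D * max_E * max_sin \<noteq> 0 \<Longrightarrow>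
       dt \<le> \<eta> * s3 * wN * ?dm * face_p T (k - 1) / (charge D * max_E * max_sin)"
    using step unfolding transport_time_step_def Let_def max_de_def max_E_def max_mu_def max_sin_def
    by blast+
  have b1: "dt / \<eta> * (max_de * max_mu) \<le> s1 * wN * ?dx"
    using st(1) \<eta> s max_de_pos max_mu_pos end_nodes faces
    by (intro time_step_bound) (auto simp: mult.assoc)
  have b2: "dt / \<eta> * (charge D * max_E * max_mu) \<le> s2 * wN * ?dp"
    using st(2) \<eta> s max_E_nonneg max_mu_pos charge_pos end_nodes faces
    by (intro time_step_bound) (auto simp: mult.assoc)
  have b3: "dt / \<eta> * (charge D * max_E * max_sin) \<le> s3 * wN * ?dm * face_p T (k - 1)"
    using st(3) \<eta> s max_E_nonneg max_sin_nonneg charge_pos end_nodes faces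
    by (intro time_step_bound) (auto simp: mult.assoc)
  define X where "X = Ip (\<lambda>p. I\<mu> (\<lambda>\<mu>. (flux_x D T f i k m p \<mu> - flux_x D T f (i - 1) k m p \<mu>) * p\<^sup>2))"
  define P where "P = Ix (\<lambda>x. I\<mu> (\<lambda>\<mu>. (face_p T k)\<^sup>2 * flux_p D T f t i k m x \<mu> -
                              (face_p T (k - 1))\<^sup>2 * flux_p D T f t i (k - 1) m x \<mu>))"
  define M where "M = Ix (\<lambda>x. Ip (\<lambda>p. ((1 - (face_mu T m)\<^sup>2) * flux_mu D T f t i k m x p -
                              (1 - (face_mu T (m - 1))\<^sup>2) * flux_mu D T f t i k (m - 1) x p) * p))"
  define S where "S = Ix (\<lambda>x. Ip (\<lambda>p. I\<mu> (\<lambda>\<mu>. u (x, p, \<mu>) * p\<^sup>2)))"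
  have \<tau>: "0 \<le> dt / \<eta>" using dt \<eta> by simp
  have "dt / \<eta> * X \<le> s1 * S" "dt / \<eta> * P \<le> s2 * S" "dt / \<eta> * M \<le> s3 * S"
    using transport_x[OF _ \<tau> b1] transport_p[OF _ \<tau> b2] transport_mu[OF _ \<tau> b3] s
    by (simp_all add: X_def P_def M_def S_def)
  then have "dt / \<eta> * X + dt / \<eta> * P + dt / \<eta> * M \<le> s1 * S + s2 * S + s3 * S" by linarith
  \<comment> \<open>The shares add up to 1: the three directions together use at most the whole
    average.\<close>
  then have "0 \<le> S - dt / \<eta> * (X + P + M)"
    using s(4) by (simp add: distrib_left flip: distrib_right)
  \<comment> \<open>Exactness replaces the integral in the average by \<open>S\<close>, a sum over
    the nodes used for the fluxes.\<close>
  moreover have "transport_part D T R f t dt \<eta> i k m =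
      1 / cell_volume T i k m * (S - dt / \<eta> * (X + P + M))"
    using exact unfolding transport_part_def cell_average_def Gamma_T_def Let_def
      exact_for_average_def tensor_quad_def X_def P_def M_def S_def
    by (simp add: diff_divide_distrib)
  ultimately show ?thesis using cell_volume_nonneg by simp
qed

end

section \<open>The collision part\<close>

text \<open>By exactness the average is a sum over the same Gauss nodes as the collision term, so
  both merge into one rule applied to p^2 times the quantity in the last hypothesis.\<close>

lemma collision_part_nonneg:
  assumes "mesh_of D T" "cell_index T i k m" "dg_function_on T f"
    and G: "gauss_rule Gx" "gauss_rule Gp" "gauss_rule Gm"
    and exact: "exact_for_average Gx Gp Gm T f i k m"
    and nn: "\<And>z. z \<in> cell_nodes T Gx Gp Gm i k m \<Longrightarrow>
      0 \<le> val f z + dt / (1 - \<eta>) * collision D A (val f) z"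
  shows "0 \<le> collision_part D T Gx Gp Gm A f dt \<eta> i k m"
proof -
  let ?TQ = "tensor_quad Gx Gp Gm T i k m"
  let ?u = "\<lambda>(x, p, \<mu>). piece f i k m (x, p, \<mu>) * p\<^sup>2"
  let ?Q = "\<lambda>(x, p, \<mu>). collision D A (val f) (x, p, \<mu>) * p\<^sup>2"
  have "0 \<le> ?TQ (\<lambda>z. ?u z + dt / (1 - \<eta>) * ?Q z)"
  proof (rule tensor_quad_nonneg[OF assms(1,2)])
    fix z assume z: "z \<in> cell_nodes T Gx Gp Gm i k m"
    obtain x p \<mu> where xp: "z = (x, p, \<mu>)" by (cases z)
    have "piece f i k m z = val f z"
      using cell_nodes_interior[OF assms(1,2) G z] assms(2,3) by (simp add: dg_function_on_def)
    then have "?u z + dt / (1 - \<eta>) * ?Q z =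
        (val f z + dt / (1 - \<eta>) * collision D A (val f) z) * p\<^sup>2"
      unfolding xp by (simp add: distrib_right)
    then show "0 \<le> ?u z + dt / (1 - \<eta>) * ?Q z" using nn[OF z] by simp
  qed (use G in \<open>auto simp: gauss_rule_def\<close>)
  also have "?TQ (\<lambda>z. ?u z + dt / (1 - \<eta>) * ?Q z) = ?TQ ?u + dt / (1 - \<eta>) * ?TQ ?Q"
    by (simp only: tensor_quad_add tensor_quad_cmult)
  finally have "0 \<le> 1 / cell_volume T i k m * (?TQ ?u + dt / (1 - \<eta>) * ?TQ ?Q)"
    using cell_volume_nonneg by (intro mult_nonneg_nonneg) auto
  then show ?thesis
    using exact unfolding collision_part_def cell_average_def Gamma_C_def exact_for_average_def
    by (simp add: distrib_left)
qed

lemma collision_ge_loss: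
  assumes D: "boltzmann_model D" and A: "positive_rule A"
    and z: "(x, p, \<mu>) \<in> cell_nodes T Gx Gp Gm i k m"
    and gain: "\<forall>z\<in>gain_nodes D T Gx Gp A i k. 0 < g z"
  shows "- (g (x, p, \<mu>) * loss_rate D p) \<le> collision D A g (x, p, \<mu>)"
proof -
  have "0 \<le> rate D j * density_factor D e * quad A (-1) 1 (\<lambda>\<mu>'. g (x, momentum D e, \<mu>'))"
    if j: "j \<in> {-1..1}" and e: "e = energy D p + of_int j * phonon D" for j e
  proof (cases "e \<in> {0..emax D}")
    case True
    have "0 \<le> quad A (-1) 1 (\<lambda>\<mu>'. g (x, momentum D e, \<mu>'))"
    proof (rule quad_nonneg[OF A])
      fix l assume "l \<in> {1..npts A}"
      then have "(x, momentum D e, qnode A (-1) 1 l) \<in> gain_nodes D T Gx Gp A i k"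
        using z j e True unfolding gain_nodes_def cell_nodes_def by blast
      then show "0 \<le> g (x, momentum D e, qnode A (-1) 1 l)" using gain by (auto intro: less_imp_le)
    qed simp
    moreover have "0 < rate D j" using D j by (auto simp: boltzmann_model_def)
    ultimately show ?thesis using density_factor_nonneg[OF D] by simp
  next
    \<comment> \<open>The cut-off removes this term, whatever value \<open>momentum D e\<close> has
      outside the range of the energy.\<close>
    case False
    then show ?thesis by (simp add: density_factor_def)
  qed
  then have "0 \<le> (\<Sum>j\<in>{-1..1::int}. let e = energy D p + of_int j * phonon D
      in rate D j * density_factor D e * quad A (-1) 1 (\<lambda>\<mu>'. g (x, momentum D e, \<mu>')))"
    unfolding Let_def by (intro sum_nonneg) blast
  then show ?thesis by (simp add: collision_def)
qed

text \<open>Without the gain there remains f (1 - dt / (1 - \<eta>) loss), whose second factor is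
  nonnegative by the time step.\<close>

lemma loss_step_nonneg:
  assumes "boltzmann_model D" "positive_rule A" "0 < dt" "\<eta> < 1"
    and z: "z \<in> cell_nodes T Gx Gp Gm i k m"
    and "0 < g z" "\<forall>z\<in>gain_nodes D T Gx Gp A i k. 0 < g z"
    and step: "loss_time_step D T Gp dt \<eta> k"
  shows "0 \<le> g z + dt / (1 - \<eta>) * collision D A g z"
proof -
  obtain x p \<mu> where xp: "z = (x, p, \<mu>)" by (cases z)
  define K where "K = Max ((\<lambda>r. loss_rate D (qnode Gp (face_p T (k - 1)) (face_p T k) r)) ` {1..npts Gp})"
  have "loss_rate D p \<le> K"
    unfolding K_def using z xp by (intro Max_ge) (auto simp: cell_nodes_def)
  have lt: "dt < (1 - \<eta>) / K" using step by (simp add: loss_time_step_def K_def)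
  \<comment> \<open>The strict restriction with \<open>0 < dt\<close> already forces
    \<open>K\<close> to be positive; \<open>K = 0\<close> would give the bound 0.\<close>
  then have "0 < (1 - \<eta>) / K" using assms(3) by linarith
  then have "0 < K" using assms(4) by (simp add: zero_less_divide_iff)
  then have "dt / (1 - \<eta>) * K \<le> 1" using lt assms(4) by (simp add: field_simps)
  moreover have "dt / (1 - \<eta>) * loss_rate D p \<le> dt / (1 - \<eta>) * K"
    using \<open>loss_rate D p \<le> K\<close> assms(3,4) by (intro mult_left_mono) auto
  ultimately have "g z * (dt / (1 - \<eta>) * loss_rate D p) \<le> g z * 1"
    using assms(6) by (intro mult_left_mono) auto
  moreover have "dt / (1 - \<eta>) * - (g z * loss_rate D p) \<le> dt / (1 - \<eta>) * collision D A g z"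
    using collision_ge_loss[OF assms(1,2) z[unfolded xp] assms(7)] assms(3,4)
    unfolding xp by (intro mult_left_mono) auto
  ultimately show ?thesis by (simp add: mult_ac)
qed

text \<open>Where Q(f) < 0 the node takes part in the minimum; elsewhere both summands are
  nonnegative.\<close>

lemma collision_step_nonneg:
  assumes "0 < dt" "\<eta> < 1"
    and z: "z \<in> cell_nodes T Gx Gp Gm i k m" and pos: "0 < val f z"
    and step: "collision_time_step D T Gx Gp Gm A f dt \<eta> i k m"
  shows "0 \<le> val f z + dt / (1 - \<eta>) * collision D A (val f) z"
proof (cases "collision D A (val f) z < 0")
  case True
  let ?Q = "collision D A (val f)"
  let ?Z = "{z \<in> cell_nodes T Gx Gp Gm i k m. ?Q z < 0}"
  have fin: "finite ?Z" by (simp add: cell_nodes_def)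
  have zZ: "z \<in> ?Z" using z True by simp
  then have "?Z \<noteq> {}" by blast
  then have "dt \<le> (1 - \<eta>) * Min ((\<lambda>z. val f z / \<bar>?Q z\<bar>) ` ?Z)"
    using step unfolding collision_time_step_def Let_def by (rule rev_mp)
  also have "\<dots> \<le> (1 - \<eta>) * (val f z / \<bar>?Q z\<bar>)"
    using fin zZ assms(2) by (intro mult_left_mono Min_le) auto
  finally have "dt / (1 - \<eta>) * \<bar>?Q z\<bar> \<le> val f z"
    using True assms(2) by (simp add: field_simps)
  then show ?thesis using True by simp
next
  case False
  then show ?thesis using assms by (intro add_nonneg_nonneg mult_nonneg_nonneg) auto
qed

section \<open>The update as a convex combination of transport and collision\<close>

theorem mainTheorem7:
  fixes D :: boltzmann_data and T :: mesh and f :: dg_function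
    and R Gx Gp Gm A :: quad_rule
    and i k m :: nat and t dt \<eta> s1 s2 s3 :: real
  assumes "boltzmann_model D" and "mesh_of D T" and "dg_function_on T f"
    and "cell_index T i k m"
    and "gauss_lobatto_rule R"
    and "gauss_rule Gx" and "gauss_rule Gp" and "gauss_rule Gm"
    and "positive_rule A"
    and "exact_for_average R R R T f i k m"
    and "exact_for_average Gx Gp Gm T f i k m"
    and "0 < dt" and "0 < \<eta>" and "\<eta> < 1"
    and "0 < s1" and "0 < s2" and "0 < s3" and "s1 + s2 + s3 = 1"
  shows
    "cell_update D T R Gx Gp Gm A f t dt i k m =
       \<eta> * transport_part D T R f t dt \<eta> i k m +
       (1 - \<eta>) * collision_part D T Gx Gp Gm A f dt \<eta> i k m
     \<and>
     (lobatto_positive T R f i k m \<and>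
      transport_time_step D T R t dt \<eta> s1 s2 s3 i k m \<longrightarrow>
        0 \<le> transport_part D T R f t dt \<eta> i k m)
     \<and>
     ((\<forall>z\<in>cell_nodes T Gx Gp Gm i k m. 0 < val f z) \<and>
      ((\<forall>z\<in>gain_nodes D T Gx Gp A i k. 0 < val f z) \<and> loss_time_step D T Gp dt \<eta> k \<or>
       collision_time_step D T Gx Gp Gm A f dt \<eta> i k m) \<longrightarrow>
        0 \<le> collision_part D T Gx Gp Gm A f dt \<eta> i k m)
     \<and>
     (lobatto_positive T R f i k m \<and>
      transport_time_step D T R t dt \<eta> s1 s2 s3 i k m \<and>
      (\<forall>z\<in>cell_nodes T Gx Gp Gm i k m. 0 < val f z) \<and>
      ((\<forall>z\<in>gain_nodes D T Gx Gp A i k. 0 < val f z) \<and> loss_time_step D T Gp dt \<eta> k \<or>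
       collision_time_step D T Gx Gp Gm A f dt \<eta> i k m) \<longrightarrow>
        0 \<le> cell_update D T R Gx Gp Gm A f t dt i k m)"
proof -
  let ?I = "transport_part D T R f t dt \<eta> i k m"
  let ?II = "collision_part D T Gx Gp Gm A f dt \<eta> i k m"
  \<comment> \<open>The weights cancel the divisions by \<open>\<eta>\<close> and
    \<open>1 - \<eta>\<close>, and the two fractions of the average add up to the whole.\<close>
  have "\<eta> * ?I = \<eta> * cell_average T f i k m + Gamma_T D T R f t dt i k m"
    "(1 - \<eta>) * ?II = (1 - \<eta>) * cell_average T f i k m + Gamma_C D T Gx Gp Gm A f dt i k m"
    using \<open>0 < \<eta>\<close> \<open>\<eta> < 1\<close> by (simp_all add: transport_part_def collision_part_def distrib_left)
  then have split: "cell_update D T R Gx Gp Gm A f t dt i k m = \<eta> * ?I + (1 - \<eta>) * ?II"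
    by (simp add: cell_update_def algebra_simps)
  have I: "0 \<le> ?I"
    if "lobatto_positive T R f i k m" "transport_time_step D T R t dt \<eta> s1 s2 s3 i k m"
  proof -
    interpret lobatto_cell D T R f t i k m
      using assms that by unfold_locales
    show ?thesis using assms that by (intro transport_part_nonneg)
  qed
  have II: "0 \<le> ?II"
    if "\<forall>z\<in>cell_nodes T Gx Gp Gm i k m. 0 < val f z"
      and "(\<forall>z\<in>gain_nodes D T Gx Gp A i k. 0 < val f z) \<and> loss_time_step D T Gp dt \<eta> k \<or>
        collision_time_step D T Gx Gp Gm A f dt \<eta> i k m"
  proof (rule collision_part_nonneg)
    fix z assume z: "z \<in> cell_nodes T Gx Gp Gm i k m"
    with that(1) have "0 < val f z" by blast
    with z that(2) show "0 \<le> val f z + dt / (1 - \<eta>) * collision D A (val f) z"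
      using loss_step_nonneg collision_step_nonneg assms by metis
  qed (use assms in auto)
  have "0 \<le> cell_update D T R Gx Gp Gm A f t dt i k m" if "0 \<le> ?I" "0 \<le> ?II"
    unfolding split using that \<open>0 < \<eta>\<close> \<open>\<eta> < 1\<close> by simp
  with split I II show ?thesis by blast
qed

end
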